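(* Let $\mu\in\mathbb{R}$ be fixed. Then the asymmetric Laplace densities $\psi(\cdot\,;\mu,\lambda,p)$, with parameters $(\lambda,p)\in(0,\infty)\times(0,1)$, define an exponential family: for all $x\in\mathbb{R}$ and all $(\lambda,p)$, $$\psi(x;\mu,\lambda,p)=h(x)\exp\left(\eta(\lambda,p)^T T(x)-A(\lambda,p)\right),$$ with $$h(x)=1,\qquad A(\lambda,p)=-\ln\beta,\qquad T(x)=\begin{bmatrix}|x-\mu|\,\mathbb{I}[x\ge\mu]\\ |x-\mu|\,\mathbb{I}[x<\mu]\end{bmatrix},\qquad \eta(\lambda,p)=\begin{bmatrix}-\lambda\alpha\\ -\lambda\alpha^{-1}\end{bmatrix}.$$
   Context: For $p\in(0,1)$, $\lambda\in(0,\infty)$, $\mu\in\mathbb{R}$, with $\alpha=\sqrt{\frac{p}{1-p}}$ and $\beta=\frac{\lambda\alpha}{\alpha^2+1}$, the asymmetric Laplace density is $$\psi(x;\mu,\lambda,p)=\begin{cases}\beta\exp(-\lambda\alpha(x-\mu)), & x\ge\mu,\\ \beta\exp(\lambda\alpha^{-1}(x-\mu)), & x<\mu.\end{cases}$$ $\mathbb{I}[\cdot]$ is the indicator function. An exponential family is a set of densities of the form $f(x\mid\theta)=h(x)\exp(\eta(\theta)^T T(x)-A(\theta))$ for given functions $h,T,\eta,A$. *)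

theory Defs
  imports "HOL-Analysis.Analysis"
begin

definition al_alpha :: "real \<Rightarrow> real" where
  "al_alpha p = sqrt (p / (1 - p))"

definition al_beta :: "real \<Rightarrow> real \<Rightarrow> real" where
  "al_beta l p = l * al_alpha p / ((al_alpha p)\<^sup>2 + 1)"

definition asym_laplace :: "real \<Rightarrow> real \<Rightarrow> real \<Rightarrow> real \<Rightarrow> real" where
  "asym_laplace \<mu> l p x =
     (if x \<ge> \<mu> then al_beta l p * exp (- l * al_alpha p * (x - \<mu>))
      else al_beta l p * exp (l * inverse (al_alpha p) * (x - \<mu>)))"

(* Densities are with respect to Lebesgue measure on the real line;
   has_bochner_integral includes Borel measurability. *)
definition prob_density :: "(real \<Rightarrow> real) \<Rightarrow> bool" where
  "prob_density f \<longleftrightarrow> (\<forall>x. 0 \<le> f x) \<and> has_bochner_integral lborel f 1"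

(* The densities f \<theta>, for \<theta> in the parameter set \<Theta>, form an exponential family with
   base function h, sufficient statistic T, natural parameter \<eta> and log-partition
   function A. *)
definition exponential_family ::
  "'t set \<Rightarrow> ('t \<Rightarrow> real \<Rightarrow> real) \<Rightarrow> (real \<Rightarrow> real) \<Rightarrow> (real \<Rightarrow> real ^ 'k)
     \<Rightarrow> ('t \<Rightarrow> real ^ 'k) \<Rightarrow> ('t \<Rightarrow> real) \<Rightarrow> bool" where
  "exponential_family \<Theta> f h T \<eta> A \<longleftrightarrow>
     (\<forall>\<theta>\<in>\<Theta>. prob_density (f \<theta>)) \<and>
     (\<forall>\<theta>\<in>\<Theta>. \<forall>x. f \<theta> x = h x * exp (\<eta> \<theta> \<bullet> T x - A \<theta>))"

end

theory Submission
  imports Defs "HOL-Real_Asymp.Real_Asymp"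
begin

text \<open>
  Up to the null set consisting of \<open>\<mu>\<close>, the density is \<open>\<beta>\<close> times the sum of two one-sided exponentials
  with rates \<open>\<lambda>\<alpha>\<close> and \<open>\<lambda>/\<alpha>\<close>, so its mass is
  \<open>\<beta> (1/(\<lambda>\<alpha>) + \<alpha>/\<lambda>) = 1\<close>. The exponential form comes from absorbing \<open>\<beta>\<close> into the
  exponent as \<open>ln \<beta>\<close>.
\<close>

lemma al_alpha_pos:
  assumes "0 < p" "p < 1"
  shows "0 < al_alpha p"
  using assms by (simp add: al_alpha_def)

lemma al_beta_pos:
  assumes "0 < l" "0 < p" "p < 1"
  shows "0 < al_beta l p"
  using assms al_alpha_pos[of p] unfolding al_beta_def
  by (intro divide_pos_pos mult_pos_pos add_nonneg_pos) auto

text \<open>The antiderivative \<open>- exp (- a * x) / a\<close> tends to 0 at infinity, so only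
  its value at 0 contributes. Since the integrand is nonnegative, computing the
  \<open>nn_integral\<close> yields integrability and value together.\<close>

lemma has_bochner_integral_exp_minus_atLeast:
  fixes a :: real
  assumes "0 < a"
  shows "has_bochner_integral lborel (\<lambda>x. exp (- a * x) * indicator {0..} x) (1 / a)"
proof (rule has_bochner_integral_nn_integral)
  have "((\<lambda>x. - exp (- a * x) / a) \<longlongrightarrow> 0) at_top"
    using assms by real_asymp
  then have "(\<integral>\<^sup>+x. ennreal (exp (- a * x)) * indicator {0..} x \<partial>lborel)
      = 0 - (- exp (- a * 0) / a)"
    using assms by (intro nn_integral_FTC_atLeast) (auto intro!: derivative_eq_intros)
  then show "(\<integral>\<^sup>+x. ennreal (exp (- a * x) * indicator {0..} x) \<partial>lborel) = ennreal (1 / a)"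
    by (simp add: ennreal_mult' ennreal_indicator)
qed (use assms in auto)

lemma prob_density_asym_laplace:
  assumes "0 < l" "0 < p" "p < 1"
  shows "prob_density (asym_laplace \<mu> l p)"
proof -
  define \<alpha> \<beta> where "\<alpha> = al_alpha p" and "\<beta> = al_beta l p"
  have \<alpha>: "0 < \<alpha>" and \<beta>: "0 < \<beta>"
    using assms by (simp_all add: \<alpha>_def \<beta>_def al_alpha_pos al_beta_pos)
  define g where "g a x = exp (- a * x) * indicator {0..} x" for a x :: real
  have g: "has_bochner_integral lborel (g a) (1 / a)" if "0 < a" for a
    using has_bochner_integral_exp_minus_atLeast[OF that] by (simp add: g_def[abs_def])
  have right: "has_bochner_integral lborel (\<lambda>x. g (l * \<alpha>) (x - \<mu>)) (1 / (l * \<alpha>))"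
    using lborel_has_bochner_integral_real_affine_iff[of 1 "g (l * \<alpha>)" "1 / (l * \<alpha>)" "- \<mu>"]
      g[of "l * \<alpha>"] assms \<alpha>
    by simp
  \<comment> \<open>The factor \<open>- 1\<close> reflects the half-line about \<mu>; its absolute
    value is 1, so the integral is unchanged.\<close>
  have left: "has_bochner_integral lborel (\<lambda>x. g (l / \<alpha>) (\<mu> - x)) (\<alpha> / l)"
    using lborel_has_bochner_integral_real_affine_iff[of "- 1" "g (l / \<alpha>)" "\<alpha> / l" \<mu>]
      g[of "l / \<alpha>"] assms \<alpha>
    by simp
  \<comment> \<open>The bracket equals \<open>(\<alpha>\<^sup>2 + 1) / (l * \<alpha>)\<close>, the
    reciprocal of \<beta>.\<close>
  have total: "\<beta> * (1 / (l * \<alpha>) + \<alpha> / l) = 1"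
  proof -
    have "\<alpha>\<^sup>2 + 1 \<noteq> 0" by (smt (verit) zero_le_power2)
    moreover have "\<beta> = l * \<alpha> / (\<alpha>\<^sup>2 + 1)" by (simp add: \<alpha>_def \<beta>_def al_beta_def)
    ultimately show ?thesis using assms \<alpha> by (simp add: field_simps power2_eq_square)
  qed
  have "has_bochner_integral lborel
      (\<lambda>x. \<beta> * (g (l * \<alpha>) (x - \<mu>) + g (l / \<alpha>) (\<mu> - x))) 1"
    using has_bochner_integral_mult_right[OF has_bochner_integral_add[OF right left], of \<beta>] total
    by simp
  \<comment> \<open>At \<mu> both closed indicators equal 1, so the sum counts \<beta> twice there;
    elsewhere exactly one term survives.\<close>
  moreover have "AE x in lborel. \<beta> * (g (l * \<alpha>) (x - \<mu>) + g (l / \<alpha>) (\<mu> - x))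
      = asym_laplace \<mu> l p x"
    using AE_lborel_singleton[of \<mu>]
  proof eventually_elim
    case (elim x)
    then show ?case
      by (auto simp: g_def asym_laplace_def \<alpha>_def \<beta>_def indicator_def divide_inverse algebra_simps)
  qed
  \<comment> \<open>Almost-everywhere equality does not by itself transfer Borel
    measurability.\<close>
  moreover have "asym_laplace \<mu> l p \<in> borel_measurable lborel"
    unfolding asym_laplace_def[abs_def] by measurable
  ultimately have "has_bochner_integral lborel (asym_laplace \<mu> l p) 1"
    using has_bochner_integral_cong_AE borel_measurable_has_bochner_integral by blast
  moreover have "0 \<le> asym_laplace \<mu> l p x" for x
    using \<beta> by (simp add: asym_laplace_def \<beta>_def)
  ultimately show ?thesis by (simp add: prob_density_def)
qed

text \<open>On each side of \<mu> one coordinate of the statistic vanishes. On the left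
  \<open>\<bar>x - \<mu>\<bar>\<close> is \<open>\<mu> - x\<close>, which accounts for the minus
  sign in the second parameter. Positivity gives
  \<open>exp (ln (al_beta l p)) = al_beta l p\<close>.\<close>

lemma asym_laplace_eq_exp:
  assumes "0 < al_beta l p"
  shows "asym_laplace \<mu> l p x =
    exp ((vector [- l * al_alpha p, - l * inverse (al_alpha p)] :: real ^ 2)
      \<bullet> vector [\<bar>x - \<mu>\<bar> * of_bool (x \<ge> \<mu>), \<bar>x - \<mu>\<bar> * of_bool (x < \<mu>)] + ln (al_beta l p))"
  using assms by (simp add: asym_laplace_def inner_vec_def sum_2 exp_add exp_diff algebra_simps)

theorem corollary4:
  fixes \<mu> :: real
  shows "exponential_family
           ({0<..} \<times> {0<..<1})
           (\<lambda>(l, p). asym_laplace \<mu> l p)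
           (\<lambda>x. 1)
           (\<lambda>x. vector [\<bar>x - \<mu>\<bar> * of_bool (x \<ge> \<mu>), \<bar>x - \<mu>\<bar> * of_bool (x < \<mu>)] :: real ^ 2)
           (\<lambda>(l, p). vector [- l * al_alpha p, - l * inverse (al_alpha p)])
           (\<lambda>(l, p). - ln (al_beta l p))"
  by (auto simp: exponential_family_def prob_density_asym_laplace al_beta_pos asym_laplace_eq_exp)

end
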